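(* Let $\mathcal{X}\subset\mathbb{R}$ be countably infinite and let $(\mathcal{Y}_x)_{x\in\mathcal{X}}$ be an independent family of random closed subsets of $\mathbb{R}$ with $P[\mathcal{Y}_x=\emptyset]=0$ for all $x\in\mathcal{X}$. Assume that each $\mathcal{Y}_x$ is first-order stationary, i.e. for all $x\in\mathcal{X}$ and all $a,b,c\in\mathbb{R}$ with $a\le b$, $P[\mathcal{Y}_x\cap[a+c,b+c]\neq\emptyset]=P[\mathcal{Y}_x\cap[a,b]\neq\emptyset]$. Let $D_x(0):=\inf\{|y|: y\in\mathcal{Y}_x\}$, let $$V:=\{(x,y)\in\mathbb{R}^2\mid x\in\mathcal{X}\Rightarrow y\in\mathcal{Y}_x\},$$ and let $C$ be the event that there exists a continuous function $f:\mathbb{R}\to\mathbb{R}$ with $f(x)\in\mathcal{Y}_x$ for all $x\in\mathcal{X}$. If $$\forall m\in\mathbb{N}\ \ \forall\varepsilon>0:\quad \sum_{x\in\mathcal{X},\,|x|\le m}P[D_x(0)>\varepsilon]<\infty,$$ then $P[C]=P[V\text{ is path-connected}]=1$. Otherwise $P[C]=P[V\text{ is path-connected}]=0$.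
   Context: All random objects are defined on a complete probability space $(\Omega,\mathcal{F},P)$. A random closed set is a random variable with values in the space of closed subsets of $\mathbb{R}$, equipped with the Borel $\sigma$-algebra generated by the Fell topology. The set $V$ is path-connected if for all $u,v\in V$ there is a continuous $f:[0,1]\to V$ with $f(0)=u$ and $f(1)=v$. That the sets $C$ and $\{V\text{ is path-connected}\}$ belong to $\mathcal{F}$ follows from the completeness of the probability space and is part of the assertion. *)

theory Defs
  imports "HOL-Probability.Probability"
begin

text \<open>The Fell topology (hit-or-miss topology) on the closed subsets of a topological space, and
  the Borel \<open>\<sigma>\<close>-algebra it generates. The carrier is the set of all closed sets, including the
  empty set: take \<open>K = {}\<close> in the second family.\<close>

definition fell_topology :: "'a::topological_space set topology" where
  "fell_topology = topology_generated_by
     ({{F. closed F \<and> F \<inter> G \<noteq> {}} | G. open G} \<union> {{F. closed F \<and> F \<inter> K = {}} | K. compact K})"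

definition fell_borel :: "'a::topological_space set measure" where
  "fell_borel = sigma {F. closed F} {U. openin fell_topology U}"

lemma topspace_fell_topology: "topspace fell_topology = {F. closed F}"
proof -
  have "{F. closed F} \<in> {{F. closed F \<and> F \<inter> K = {}} | K :: 'a set. compact K}"
    by (rule CollectI, rule exI[of _ "{}"]) auto
  then show ?thesis
    unfolding fell_topology_def topology_generated_by_topspace by blast
qed

lemma fell_open_subset_Pow: "{U. openin fell_topology U} \<subseteq> Pow {F. closed F}"
  using openin_subset[where U = fell_topology] by (auto simp: topspace_fell_topology)

lemma space_fell_borel: "space fell_borel = {F. closed F}"
  unfolding fell_borel_def by (rule space_measure_of[OF fell_open_subset_Pow])

lemma sets_fell_borel:
  "sets fell_borel = sigma_sets {F. closed F} {U. openin fell_topology U}"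
  unfolding fell_borel_def by (rule sets_measure_of[OF fell_open_subset_Pow])

definition random_closed_set :: "'w measure \<Rightarrow> ('w \<Rightarrow> real set) \<Rightarrow> bool" where
  "random_closed_set M Z \<longleftrightarrow> Z \<in> measurable M fell_borel"

definition first_order_stationary :: "'w measure \<Rightarrow> ('w \<Rightarrow> real set) \<Rightarrow> bool" where
  "first_order_stationary M Z \<longleftrightarrow>
     (\<forall>a b c. a \<le> b \<longrightarrow>
        measure M {\<omega> \<in> space M. Z \<omega> \<inter> {a + c..b + c} \<noteq> {}} =
        measure M {\<omega> \<in> space M. Z \<omega> \<inter> {a..b} \<noteq> {}})"

text \<open>Distance from \<open>0\<close> to a set, with value \<open>\<infinity>\<close> for the empty set.\<close>

definition dist_zero :: "real set \<Rightarrow> ereal" where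
  "dist_zero F = (INF y\<in>F. ereal \<bar>y\<bar>)"

definition V_set :: "real set \<Rightarrow> (real \<Rightarrow> real set) \<Rightarrow> (real \<times> real) set" where
  "V_set X F = {(x, y). x \<in> X \<longrightarrow> y \<in> F x}"

definition event_C :: "'w measure \<Rightarrow> real set \<Rightarrow> (real \<Rightarrow> 'w \<Rightarrow> real set) \<Rightarrow> 'w set" where
  "event_C M X Y =
     {\<omega> \<in> space M. \<exists>f :: real \<Rightarrow> real. continuous_on UNIV f \<and> (\<forall>x\<in>X. f x \<in> Y x \<omega>)}"

definition event_path_connected ::
    "'w measure \<Rightarrow> real set \<Rightarrow> (real \<Rightarrow> 'w \<Rightarrow> real set) \<Rightarrow> 'w set" where
  "event_path_connected M X Y = {\<omega> \<in> space M. path_connected (V_set X (\<lambda>x. Y x \<omega>))}"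

end

theory Submission
  imports Defs
begin

text \<open>By stationarity the event that \<open>Y x\<close> has distance more than \<open>\<epsilon>\<close> from \<open>q\<close> has the same
  probability for all \<open>q\<close>. If the sums converge, Borel--Cantelli yields almost surely that, for all
  bounds \<open>m\<close>, \<open>R\<close> and \<open>\<epsilon> > 0\<close>, all but finitely many of the fibres \<open>Y x\<close> with \<open>\<bar>x\<bar> \<le> m\<close> are
  \<open>\<epsilon>\<close>-dense in \<open>{-R..R}\<close>. Then a continuous selection is the uniform limit of functions that meet
  the fibres over larger and larger finite sets \<open>P k\<close>, where the \<open>k\<close>-th correction has size at most
  \<open>(1/2)^k\<close> because \<open>P k\<close> contains all fibres that are not \<open>(1/2)^k\<close>-dense. Selections with
  prescribed values at two points give paths in \<open>V_set\<close>.

  If a sum diverges, it does so on every one-sided neighbourhood of some point \<open>z\<close>. By independence,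
  almost surely for every rational \<open>q\<close> there are points \<open>x\<close> of \<open>X\<close> arbitrarily close to \<open>z\<close> on that
  side whose fibre misses \<open>{q-\<epsilon>..q+\<epsilon>}\<close>. A path in \<open>V_set\<close> that leaves the line over \<open>z\<close> towards
  that side at height \<open>a\<close> meets the fibres of all nearby \<open>x\<close> close to \<open>a\<close>, a contradiction.\<close>

section \<open>Continuous selections when all but finitely many fibres are dense\<close>

text \<open>Tietze's theorem on a finite, hence closed, set, where every function is continuous.
  Keeping the bound \<open>B\<close> is what later makes the corrections summable.\<close>

lemma continuous_extension_finite:
  fixes v :: "real \<Rightarrow> real"
  assumes "finite P" "0 \<le> B" "\<And>x. x \<in> P \<Longrightarrow> \<bar>v x\<bar> \<le> B"
  obtains g :: "real \<Rightarrow> real" where "continuous_on UNIV g" "\<And>x. x \<in> P \<Longrightarrow> g x = v x"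
    "\<And>x. \<bar>g x\<bar> \<le> B"
proof -
  have "closedin (top_of_set UNIV) P"
    using assms(1) by (simp add: finite_imp_closed)
  then show ?thesis
    using Tietze[of P v UNIV B] assms that continuous_on_finite[OF assms(1)] by auto
qed

lemma continuous_selection:
  fixes X :: "real set" and F :: "real \<Rightarrow> real set"
  assumes "countable X" and ne: "\<And>x. x \<in> X \<Longrightarrow> F x \<noteq> {}"
    and fin: "\<And>R e. e > 0 \<Longrightarrow> finite {x\<in>X. \<exists>y. \<bar>y\<bar> \<le> R \<and> F x \<inter> {y-e..y+e} = {}}"
  obtains f where "continuous_on UNIV f" "\<And>x. x \<in> X \<Longrightarrow> f x \<in> F x"
proof -
  \<comment> \<open>Values in \<open>{-1..1}\<close> wherever possible make \<open>p\<close> bounded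
    on all of \<open>X\<close>. The bound \<open>R\<close> must be known before the sets
    \<open>bad k\<close> and \<open>P k\<close>, which are defined through it.\<close>
  define p where "p x = (if F x \<inter> {-1..1} = {} then SOME y. y \<in> F x else SOME y. y \<in> F x \<inter> {-1..1})" for x
  have pF: "p x \<in> F x" if "x \<in> X" for x
    using ne[OF that] unfolding p_def
    by (auto simp: some_in_eq) (metis (no_types, lifting) Int_iff empty_iff equals0I someI_ex)
  have p1: "\<bar>p x\<bar> \<le> 1" if "F x \<inter> {-1..1} \<noteq> {}" for x
  proof -
    have "p x \<in> F x \<inter> {-1..1}"
      unfolding p_def using that by (simp only: if_False) (rule someI_ex, blast)
    then show ?thesis by auto
  qed
  define B where "B = {x\<in>X. F x \<inter> {-1..1} = {}}"
  have "finite B"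
    using fin[of 1 0] unfolding B_def by (rule finite_subset[rotated]) auto
  define R where "R = 1 + (\<Sum>x\<in>B. \<bar>p x\<bar>)"
  have R1: "1 \<le> R"
    by (simp add: R_def sum_nonneg)
  have pR: "\<bar>p x\<bar> \<le> R" if "x \<in> X" for x
  proof (cases "x \<in> B")
    case True
    then have "\<bar>p x\<bar> \<le> (\<Sum>x\<in>B. \<bar>p x\<bar>)"
      using member_le_sum[of x B "\<lambda>x. \<bar>p x\<bar>"] \<open>finite B\<close> by auto
    then show ?thesis by (simp add: R_def)
  next
    case False
    then show ?thesis using p1[of x] R1 that by (auto simp: B_def)
  qed
  \<comment> \<open>The approximants stay below \<open>R + (1 + 1/2 + 1/4 + \<dots>) = R + 2\<close>.\<close>
  define bad where "bad k = {x\<in>X. \<exists>y. \<bar>y\<bar> \<le> R + 2 \<and> F x \<inter> {y-(1/2)^k..y+(1/2)^k} = {}}" for k :: nat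
  \<comment> \<open>The points of index below \<open>k\<close> are added so that every
    \<open>x\<close> in \<open>X\<close> lies in \<open>P k\<close> for all large
    \<open>k\<close>.\<close>
  define P where "P k = bad k \<union> {x\<in>X. to_nat_on X x < k}" for k
  have finP: "finite (P k)" for k
  proof -
    have "finite {x\<in>X. to_nat_on X x < k}"
      by (rule finite_imageD[of "to_nat_on X"], rule finite_subset[of _ "{..<k}"])
        (auto intro: inj_on_subset[OF inj_on_to_nat_on[OF assms(1)]])
    then show ?thesis
      unfolding P_def bad_def using fin[of "(1/2)^k" "R+2"] by simp
  qed
  have PX: "P k \<subseteq> X" for k
    by (auto simp: P_def bad_def)
  have bad_mono: "bad k \<subseteq> bad (Suc k)" for k
  proof -
    have "{y-(1/2)^Suc k..y+(1/2)^Suc k} \<subseteq> {y-(1/2)^k..y+(1/2)^k}" for y :: real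
      by (auto simp: field_simps)
    then show ?thesis unfolding bad_def by blast
  qed
  have P_mono: "P k \<subseteq> P (Suc k)" for k
    using bad_mono[of k] by (auto simp: P_def)
  have good: "\<exists>z\<in>F x. \<bar>z - y\<bar> \<le> (1/2)^k" if "x \<in> X - P k" "\<bar>y\<bar> \<le> R + 2" for x y k
  proof -
    have "F x \<inter> {y-(1/2)^k..y+(1/2)^k} \<noteq> {}"
      using that unfolding P_def bad_def by auto
    then obtain z where "z \<in> F x" "z \<in> {y-(1/2)^k..y+(1/2)^k}" by blast
    then show ?thesis by (intro bexI[of _ z]) (auto simp: abs_le_iff)
  qed
  \<comment> \<open>The bound equals \<open>R\<close> at \<open>k = 0\<close> and grows by exactly
    \<open>(1/2)^k\<close> from stage \<open>k\<close> to the next, the size of the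
    correction.\<close>
  define Inv where "Inv k f \<longleftrightarrow> continuous_on UNIV f \<and> (\<forall>x\<in>P k. f x \<in> F x) \<and>
      (\<forall>x. \<bar>f x\<bar> \<le> R + 2 - 2 * (1/2)^k)" for k and f :: "real \<Rightarrow> real"
  have "\<exists>f. Inv 0 f"
  proof -
    have "0 \<le> R" using R1 by simp
    moreover have "\<bar>p x\<bar> \<le> R" if "x \<in> P 0" for x
      using pR PX that by blast
    ultimately obtain g where "continuous_on UNIV g" "\<And>x. x \<in> P 0 \<Longrightarrow> g x = p x" "\<And>x. \<bar>g x\<bar> \<le> R"
      using continuous_extension_finite[OF finP[of 0] , of R p] by blast
    then have "Inv 0 g"
      using pF PX[of 0] unfolding Inv_def by (simp add: subset_iff)
    then show ?thesis by blast
  qed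
  moreover have "\<exists>g. Inv (Suc k) g \<and> ((\<forall>x. \<bar>g x - f x\<bar> \<le> (1/2)^k) \<and> (\<forall>x\<in>P k. g x = f x))"
    if f: "Inv k f" for f k
  proof -
    have "\<bar>f x\<bar> \<le> R + 2" for x
    proof -
      have "\<bar>f x\<bar> \<le> R + 2 - 2 * (1/2)^k" using f by (simp add: Inv_def)
      moreover have "0 \<le> (1/2::real)^k" by simp
      ultimately show ?thesis by linarith
    qed
    then have "\<exists>z. z \<in> F x \<and> \<bar>z - f x\<bar> \<le> (1/2)^k" if "x \<in> X - P k" for x
      using good[OF that] by blast
    then obtain z where z: "\<And>x. x \<in> X - P k \<Longrightarrow> z x \<in> F x \<and> \<bar>z x - f x\<bar> \<le> (1/2)^k" by metis
    \<comment> \<open>Zero on \<open>P k\<close>, so fibres already met are not left again; on new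
      points the correction moves \<open>f x\<close> into the fibre.\<close>
    define v where "v x = (if x \<in> P k then 0 else z x - f x)" for x
    have "\<bar>v x\<bar> \<le> (1/2)^k" if "x \<in> P (Suc k)" for x
      using z[of x] PX that unfolding v_def by (auto simp: subset_iff)
    then obtain h where h: "continuous_on UNIV h" "\<And>x. x \<in> P (Suc k) \<Longrightarrow> h x = v x" "\<And>x. \<bar>h x\<bar> \<le> (1/2)^k"
      using continuous_extension_finite[of "P (Suc k)" "(1/2)^k" v] finP by auto
    have "Inv (Suc k) (\<lambda>x. f x + h x)"
      unfolding Inv_def
    proof (intro conjI ballI allI)
      show "continuous_on UNIV (\<lambda>x. f x + h x)"
        using f h(1) by (auto simp: Inv_def intro: continuous_on_add)
      show "f x + h x \<in> F x" if "x \<in> P (Suc k)" for x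
        using h(2)[OF that] f z[of x] PX that by (auto simp: v_def Inv_def subset_iff)
      show "\<bar>f x + h x\<bar> \<le> R + 2 - 2 * (1/2)^Suc k" for x
      proof -
        have "\<bar>f x\<bar> \<le> R + 2 - 2 * (1/2)^k" using f by (simp add: Inv_def)
        then show ?thesis using h(3)[of x] by simp
      qed
    qed
    then show ?thesis
      using h P_mono[of k] by (intro exI[of _ "\<lambda>x. f x + h x"]) (auto simp: v_def)
  qed
  ultimately obtain f where "\<forall>n. Inv n (f n) \<and> ((\<forall>x. \<bar>f (Suc n) x - f n x\<bar> \<le> (1/2)^n) \<and> (\<forall>x\<in>P n. f (Suc n) x = f n x))"
    using dependent_nat_choice[of Inv "\<lambda>n f g. (\<forall>x. \<bar>g x - f x\<bar> \<le> (1/2)^n) \<and> (\<forall>x\<in>P n. g x = f x)"]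
    by blast
  then have f: "\<And>n. Inv n (f n)" "\<And>n x. \<bar>f (Suc n) x - f n x\<bar> \<le> (1/2)^n"
      "\<And>n x. x \<in> P n \<Longrightarrow> f (Suc n) x = f n x"
    by auto
  have tele: "(\<Sum>i<n. f (Suc i) x - f i x) = f n x - f 0 x" for n x
    using sum_lessThan_telescope[of "\<lambda>i. f i x" n] by simp
  \<comment> \<open>Summing the increments gives access to the Weierstrass M-test; the selection
    itself is \<open>g\<close> plus \<open>f 0\<close>.\<close>
  define g where "g x = (\<Sum>i. f (Suc i) x - f i x)" for x
  have "uniform_limit UNIV (\<lambda>n x. \<Sum>i<n. f (Suc i) x - f i x) g sequentially"
    unfolding g_def
    by (rule Weierstrass_m_test[of _ _ "\<lambda>i. (1/2)^i"]) (use f(2) in auto)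
  then have lim: "uniform_limit UNIV (\<lambda>n x. f n x - f 0 x) g sequentially"
    by (simp add: tele)
  have "continuous_on UNIV g"
    by (rule uniform_limit_theorem[OF always_eventually lim])
      (use f(1) in \<open>auto simp: Inv_def intro!: continuous_on_diff\<close>)
  moreover have "g x + f 0 x \<in> F x" if "x \<in> X" for x
  proof -
    \<comment> \<open>From stage \<open>N\<close> on the index of \<open>x\<close> is below
      \<open>n\<close>, so the values \<open>f n x\<close> are constant and lie in
      \<open>F x\<close>.\<close>
    define N where "N = Suc (to_nat_on X x)"
    have xP: "x \<in> P n" if "n \<ge> N" for n
      using that \<open>x \<in> X\<close> by (auto simp: P_def N_def)
    have eq: "f n x = f N x" if "n \<ge> N" for n
      using that by (induction n rule: dec_induct) (use f(3) xP in auto)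
    have "(\<lambda>n. f n x - f 0 x) \<longlonglongrightarrow> g x"
      using tendsto_uniform_limitI[OF lim] by auto
    moreover have "(\<lambda>n. f n x - f 0 x) \<longlonglongrightarrow> f N x - f 0 x"
      by (rule tendsto_eventually, rule eventually_sequentiallyI[of N], subst eq) auto
    ultimately have "g x = f N x - f 0 x"
      by (rule LIMSEQ_unique)
    then show ?thesis using f(1)[of N] xP[of N] by (auto simp: Inv_def)
  qed
  ultimately show ?thesis
    using that[of "\<lambda>x. g x + f 0 x"] f(1)[of 0] by (auto simp: Inv_def intro: continuous_on_add)
qed

text \<open>The values are prescribed by making the fibres over \<open>u\<close> and
  \<open>v\<close> singletons, after adding both points to \<open>X\<close>. Changing two fibres
  preserves the finiteness condition.\<close>

lemma continuous_selection_two_points: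
  fixes X :: "real set" and F :: "real \<Rightarrow> real set"
  assumes "countable X" and ne: "\<And>x. x \<in> X \<Longrightarrow> F x \<noteq> {}"
    and fin: "\<And>R e. e > 0 \<Longrightarrow> finite {x\<in>X. \<exists>y. \<bar>y\<bar> \<le> R \<and> F x \<inter> {y-e..y+e} = {}}"
    and "u \<noteq> v" "u \<in> X \<Longrightarrow> a \<in> F u" "v \<in> X \<Longrightarrow> b \<in> F v"
  obtains f where "continuous_on UNIV f" "\<And>x. x \<in> X \<Longrightarrow> f x \<in> F x" "f u = a" "f v = b"
proof -
  define G where "G = (F(u := {a}))(v := {b})"
  obtain f where "continuous_on UNIV f" "\<And>x. x \<in> insert u (insert v X) \<Longrightarrow> f x \<in> G x"
  proof (rule continuous_selection)
    show "countable (insert u (insert v X))" using assms(1) by simp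
    show "G x \<noteq> {}" if "x \<in> insert u (insert v X)" for x
      using that ne by (auto simp: G_def)
    show "finite {x \<in> insert u (insert v X). \<exists>y. \<bar>y\<bar> \<le> R \<and> G x \<inter> {y-e..y+e} = {}}" if "e > 0" for R e
      by (rule finite_subset[of _ "insert u (insert v {x\<in>X. \<exists>y. \<bar>y\<bar> \<le> R \<and> F x \<inter> {y-e..y+e} = {}})"])
        (use fin[OF that] in \<open>auto simp: G_def split: if_splits\<close>)
  qed blast
  then show ?thesis
    using that[of f] assms(4-) by (fastforce simp: G_def split: if_splits)
qed

section \<open>Gluing selections and path-connectedness\<close>

text \<open>The deterministic condition that realisations satisfy almost surely in the convergent
  case. Finiteness is only required for bounded \<open>x\<close>, so selections on the whole line
  have to be glued.\<close>

locale locally_full =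
  fixes X :: "real set" and F :: "real \<Rightarrow> real set"
  assumes count: "countable X"
    and nonempty: "\<And>x. x \<in> X \<Longrightarrow> F x \<noteq> {}"
    and fin: "\<And>m R e. e > 0 \<Longrightarrow> finite {x\<in>X. \<bar>x\<bar> \<le> real m \<and> (\<exists>y. \<bar>y\<bar> \<le> R \<and> F x \<inter> {y-e..y+e} = {})}"
begin

lemma selection_on_interval:
  assumes "u < v" "u \<in> X \<Longrightarrow> a \<in> F u" "v \<in> X \<Longrightarrow> b \<in> F v"
  obtains f where "continuous_on UNIV f" "\<And>x. x \<in> X \<inter> {u..v} \<Longrightarrow> f x \<in> F x" "f u = a" "f v = b"
proof -
  have fin': "finite {x \<in> X \<inter> {u..v}. \<exists>y. \<bar>y\<bar> \<le> R \<and> F x \<inter> {y-e..y+e} = {}}" if "e > 0" for R e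
  proof -
    obtain m :: nat where "max \<bar>u\<bar> \<bar>v\<bar> \<le> real m" using real_arch_simple by blast
    then have "\<bar>x\<bar> \<le> real m" if "x \<in> {u..v}" for x using that by auto
    then show ?thesis
      by (intro finite_subset[OF _ fin[OF that, of m R]]) auto
  qed
  show ?thesis
    by (rule continuous_selection_two_points[where X = "X \<inter> {u..v}" and F = F and u = u and v = v and a = a and b = b])
      (use assms count nonempty fin' that in auto)
qed

text \<open>Selections on the intervals between consecutive integers are pasted. This closed cover
  is locally finite, and neighbouring pieces share the value of \<open>c\<close> at their common
  endpoint.\<close>

lemma selection:
  obtains f where "continuous_on UNIV f" "\<And>x. x \<in> X \<Longrightarrow> f x \<in> F x"
proof -
  \<comment> \<open>Outside \<open>X\<close> the value of \<open>c\<close> is arbitrary; at integers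
    it only has to be the same for both adjacent pieces.\<close>
  obtain c where c: "\<And>x. x \<in> X \<Longrightarrow> c x \<in> F x"
    using that[of "\<lambda>x. SOME y. y \<in> F x"] nonempty by (simp add: some_in_eq)
  have "\<exists>h. continuous_on UNIV h \<and> (\<forall>x\<in>X \<inter> {real_of_int j..real_of_int j+1}. h x \<in> F x) \<and>
      h (real_of_int j) = c (real_of_int j) \<and> h (real_of_int j+1) = c (real_of_int j+1)" for j :: int
    by (rule selection_on_interval[of "real_of_int j" "real_of_int j+1" "c (real_of_int j)" "c (real_of_int j+1)"])
      (use c in auto)
  then obtain h where "\<forall>j. continuous_on UNIV (h j) \<and> (\<forall>x\<in>X \<inter> {real_of_int j..real_of_int j+1}. h j x \<in> F x) \<and>
      h j (real_of_int j) = c (real_of_int j) \<and> h j (real_of_int j+1) = c (real_of_int j+1)"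
    by (rule choice[OF allI, THEN exE])
  then have h: "\<And>j::int. continuous_on UNIV (h j)"
      "\<And>j x. x \<in> X \<Longrightarrow> real_of_int j \<le> x \<Longrightarrow> x \<le> real_of_int j+1 \<Longrightarrow> h j x \<in> F x"
      "\<And>j. h j (real_of_int j) = c (real_of_int j)" "\<And>j. h j (real_of_int j+1) = c (real_of_int j+1)"
    by auto
  define f where "f x = h \<lfloor>x\<rfloor> x" for x
  have "continuous_map euclidean euclidean f"
  proof (rule pasting_lemma_locally_finite[where I = UNIV and T = "\<lambda>j. {real_of_int j..real_of_int j+1}" and f = h])
    show "\<exists>V. openin euclidean V \<and> x \<in> V \<and> finite {i \<in> UNIV. {real_of_int i..real_of_int i+1} \<inter> V \<noteq> {}}" for x :: real
    proof (intro exI conjI)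
      show "finite {i \<in> UNIV. {real_of_int i..real_of_int i+1} \<inter> {x-1<..<x+1} \<noteq> {}}"
      proof (rule finite_subset)
        show "{i \<in> UNIV. {real_of_int i..real_of_int i+1} \<inter> {x-1<..<x+1} \<noteq> {}} \<subseteq> {\<lfloor>x\<rfloor>-3..\<lfloor>x\<rfloor>+3}"
          by auto linarith+
      qed simp
    qed auto
    show "closedin euclidean {real_of_int i..real_of_int i+1}" for i by simp
    show "continuous_map (subtopology euclidean {real_of_int i..real_of_int i+1}) euclidean (h i)" for i
      using continuous_on_subset[OF h(1)[of i]] by simp
    show "h i x = h j x" if "x \<in> topspace euclidean \<inter> {real_of_int i..real_of_int i+1} \<inter> {real_of_int j..real_of_int j+1}" for i j x
    proof -
      have "i = j \<or> j = i + 1 \<and> x = real_of_int i + 1 \<or> i = j + 1 \<and> x = real_of_int j + 1"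
        using that by (simp; linarith)
      then show ?thesis
        using h(3)[of "i+1"] h(3)[of "j+1"] h(4)[of i] h(4)[of j] by auto
    qed
    show "\<exists>j. j \<in> UNIV \<and> x \<in> {real_of_int j..real_of_int j+1} \<and> f x = h j x" for x
      unfolding f_def by (rule exI[of _ "\<lfloor>x\<rfloor>"]) (simp; linarith)
  qed
  then have "continuous_on UNIV f" by simp
  moreover have "f x \<in> F x" if "x \<in> X" for x
    unfolding f_def by (rule h(2)[OF that]) linarith+
  ultimately show ?thesis using that by blast
qed

text \<open>The path is the graph over \<open>{u..v}\<close> of a selection with values
  \<open>a\<close> and \<open>b\<close> at the ends.\<close>

lemma V_path_component_less:
  assumes "(u, a) \<in> V_set X F" "(v, b) \<in> V_set X F" "u < v"
  shows "path_component (V_set X F) (u, a) (v, b)"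
proof -
  obtain f where f: "continuous_on UNIV f" "\<And>x. x \<in> X \<inter> {u..v} \<Longrightarrow> f x \<in> F x" "f u = a" "f v = b"
    using selection_on_interval[of u v a b] assms by (auto simp: V_set_def)
  have "path_component (V_set X F) (u, f u) (v, f v)"
    unfolding path_component_def
  proof (intro exI conjI)
    let ?l = "linepath u v" let ?g = "\<lambda>t. (?l t, f (?l t))"
    have "continuous_on {0..1} (\<lambda>t. f (?l t))"
      using continuous_on_compose2[OF f(1) continuous_on_linepath] by auto
    then show "path ?g" by (auto simp: path_def intro: continuous_on_Pair)
    have "?l t \<in> {u..v}" if "t \<in> {0..1}" for t
      using that linepath_in_path[of t u v] assms(3) by (simp add: closed_segment_eq_real_ivl)
    then show "path_image ?g \<subseteq> V_set X F"
      using f(2) by (auto simp: path_image_def V_set_def)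
  qed (auto simp: pathstart_def pathfinish_def linepath_def)
  then show ?thesis using f by simp
qed

lemma V_path_connected: "path_connected (V_set X F)"
proof -
  have "path_component (V_set X F) (u, a) (v, b)"
    if uv: "(u, a) \<in> V_set X F" "(v, b) \<in> V_set X F" for u a v b
  proof (cases u v rule: linorder_cases)
    \<comment> \<open>If \<open>u\<close> is in \<open>X\<close>, the vertical segment between the
      points may leave the set, so the path makes a detour through a point over
      \<open>u + 1\<close>.\<close>
    case equal
    obtain c where c: "(u + 1, c) \<in> V_set X F"
      using nonempty[of "u+1"] by (cases "u + 1 \<in> X") (auto simp: V_set_def)
    then show ?thesis
      using V_path_component_less[OF uv(1) c] V_path_component_less[OF uv(2) c] equal
      by (metis less_add_one path_component_sym path_component_trans)
  qed (use V_path_component_less uv path_component_sym in blast)+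
  then show ?thesis
    unfolding path_connected_component by auto
qed

end

section \<open>Fibres with gaps near a point obstruct paths\<close>

text \<open>The sign \<open>s\<close> selects the side of \<open>z\<close>, and \<open>h\<close> is
  the signed distance from the line over \<open>z\<close> towards that side. Just after the path
  last leaves this line, \<open>h\<close> takes all small positive values while the height moves by
  less than \<open>e/2\<close>.\<close>

lemma no_path_V_set:
  fixes s :: real
  assumes "\<bar>s\<bar> = 1" "e > 0"
    and miss: "\<And>q r. q \<in> \<rat> \<Longrightarrow> r > 0 \<Longrightarrow> \<exists>x\<in>X. 0 < s * (x - z) \<and> s * (x - z) < r \<and> F x \<inter> {q-e..q+e} = {}"
    and g: "path g" "path_image g \<subseteq> V_set X F" "fst (pathstart g) = z" "fst (pathfinish g) = z + s"
  shows False
proof -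
  have ss: "s * s = 1" using assms(1) by (cases "s \<ge> 0") auto
  define h where "h t = s * (fst (g t) - z)" for t
  have cg: "continuous_on {0..1} g" using g(1) by (simp add: path_def)
  have ch: "continuous_on {0..1} h" unfolding h_def by (intro continuous_intros cg)
  have h01: "h 0 = 0" "h 1 = 1" using g(3,4) ss by (auto simp: h_def pathstart_def pathfinish_def)
  \<comment> \<open>The last time \<open>t0\<close> at which the path is over \<open>z\<close>.\<close>
  define Z where "Z = {t\<in>{0..1}. h t = 0}"
  have "compact Z"
  proof -
    have "closed Z" unfolding Z_def by (rule continuous_closed_preimage_constant[OF ch]) simp
    moreover have "bounded Z" by (rule bounded_subset[of "{0..1}"]) (auto simp: Z_def)
    ultimately show ?thesis by (simp add: compact_eq_bounded_closed)
  qed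
  moreover have "0 \<in> Z" using h01 by (simp add: Z_def)
  ultimately obtain t0 where t0: "t0 \<in> Z" "\<And>t. t \<in> Z \<Longrightarrow> t \<le> t0"
    using compact_attains_sup[of Z] by auto
  have t01: "0 \<le> t0" "t0 < 1" "h t0 = 0"
    using t0(1) h01 by (auto simp: Z_def less_le)
  have cs: "continuous_on {0..1} (\<lambda>t. snd (g t))" by (intro continuous_intros cg)
  obtain d where d: "d > 0" "\<And>t. t \<in> {0..1} \<Longrightarrow> \<bar>t - t0\<bar> < d \<Longrightarrow> \<bar>snd (g t) - snd (g t0)\<bar> < e/2"
    using cs t01 \<open>e > 0\<close> unfolding continuous_on_iff dist_real_def
    by (metis atLeastAtMost_iff half_gt_zero less_imp_le)
  define t1 where "t1 = min 1 (t0 + d/2)"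
  have t1: "t0 < t1" "t1 \<le> 1" "t1 < t0 + d" using d t01 by (auto simp: t1_def min_def)
  \<comment> \<open>Otherwise, as \<open>h 1 = 1\<close>, there would be a zero of \<open>h\<close>
    in \<open>{t1..1}\<close>, later than \<open>t0\<close>.\<close>
  have pos: "h t1 > 0"
  proof (rule ccontr)
    assume "\<not> h t1 > 0"
    then obtain t where "t1 \<le> t" "t \<le> 1" "h t = 0"
      using IVT'[of h t1 0 1] h01 t1 continuous_on_subset[OF ch, of "{t1..1}"] t01 by auto
    then have "t \<in> Z" using t1 t01 by (auto simp: Z_def)
    then show False using t0(2) \<open>t1 \<le> t\<close> t1 by fastforce
  qed
  \<comment> \<open>The tolerance \<open>e\<close> is split: \<open>e/2\<close> for the rational
    approximation of the height at \<open>t0\<close>, \<open>e/2\<close> for the movement up to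
    \<open>t1\<close>.\<close>
  obtain q where q: "q \<in> \<rat>" "snd (g t0) < q" "q < snd (g t0) + e/2"
    using Rats_dense_in_real[of "snd (g t0)" "snd (g t0) + e/2"] \<open>e > 0\<close> by auto
  obtain x where x: "x \<in> X" "0 < s * (x - z)" "s * (x - z) < h t1" "F x \<inter> {q-e..q+e} = {}"
    using miss[OF q(1) pos] by blast
  obtain t where t: "t0 \<le> t" "t \<le> t1" "h t = s * (x - z)"
    using IVT'[of h t0 "s * (x - z)" t1] x t1 t01 continuous_on_subset[OF ch, of "{t0..t1}"] by auto
  then have "s * (s * (fst (g t) - z)) = s * (s * (x - z))" by (simp add: h_def)
  then have "fst (g t) = x" using ss by (simp flip: mult.assoc)
  moreover have t': "t \<in> {0..1}" using t t1 t01 by auto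
  ultimately have "snd (g t) \<in> F x"
    using g(2) x(1) by (auto simp: path_image_def V_set_def subset_iff)
  moreover have "snd (g t) \<in> {q-e..q+e}"
  proof -
    have "\<bar>snd (g t) - snd (g t0)\<bar> < e/2"
      by (rule d(2)[OF t']) (use t t1 in linarith)
    then have "q - e \<le> snd (g t)" "snd (g t) \<le> q + e"
      using q(2,3) by linarith+
    then show ?thesis by simp
  qed
  ultimately show False using x(4) by blast
qed

section \<open>Hitting events and the distance from the origin\<close>

lemma fell_borel_miss:
  assumes "compact K"
  shows "{F\<in>space fell_borel. F \<inter> K = {}} \<in> sets fell_borel"
proof -
  have "openin fell_topology {F. closed F \<and> F \<inter> K = {}}"
    unfolding fell_topology_def using assms by (intro topology_generated_by_Basis) blast
  then show ?thesis
    unfolding sets_fell_borel space_fell_borel by (auto intro: sigma_sets.Basic)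
qed

lemma fell_borel_hit:
  assumes "open G"
  shows "{F\<in>space fell_borel. F \<inter> G \<noteq> {}} \<in> sets fell_borel"
proof -
  have "openin fell_topology {F. closed F \<and> F \<inter> G \<noteq> {}}"
    unfolding fell_topology_def using assms by (intro topology_generated_by_Basis) blast
  then show ?thesis
    unfolding sets_fell_borel space_fell_borel by (auto intro: sigma_sets.Basic)
qed

text \<open>A nonempty closed set has a point nearest to \<open>0\<close>, so the infimum is
  attained and the inequality stays strict. The empty set has distance \<infinity> and misses every
  interval.\<close>

lemma less_dist_zero_iff:
  assumes "closed F"
  shows "ereal e < dist_zero F \<longleftrightarrow> F \<inter> {-e..e} = {}"
proof
  assume "ereal e < dist_zero F"
  then have "e < \<bar>y\<bar>" if "y \<in> F" for y
    using that unfolding dist_zero_def by (meson INF_lower ereal_less_eq(3) leD leI order_trans)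
  then show "F \<inter> {-e..e} = {}" by fastforce
next
  assume *: "F \<inter> {-e..e} = {}"
  show "ereal e < dist_zero F"
  proof (cases "F = {}")
    case False
    then obtain y where y: "y \<in> F" "\<And>x. x \<in> F \<Longrightarrow> \<bar>y\<bar> \<le> \<bar>x\<bar>"
      using distance_attains_inf[OF assms, of 0] by auto
    then have "ereal \<bar>y\<bar> \<le> dist_zero F"
      unfolding dist_zero_def by (intro INF_greatest) auto
    moreover have "e < \<bar>y\<bar>" using * y(1) by force
    ultimately show ?thesis by (meson ereal_less_eq(3) less_le_trans less_ereal.simps(1))
  qed (simp add: dist_zero_def top_ereal_def)
qed

section \<open>Borel-Cantelli arguments, divergence at a point, completeness\<close>

text \<open>The first Borel-Cantelli lemma, carried from sequences to a countable index set by an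
  enumeration.\<close>

lemma (in prob_space) AE_finite_if_summable_on:
  assumes "countable I" "\<And>i. i \<in> I \<Longrightarrow> A i \<in> events" "(\<lambda>i. prob (A i)) summable_on I"
  shows "AE \<omega> in M. finite {i\<in>I. \<omega> \<in> A i}"
proof (cases "finite I")
  case False
  let ?e = "from_nat_into I"
  have "bij_betw ?e UNIV I"
    using bij_betw_from_nat_into[OF assms(1) False] .
  then have "(\<lambda>n. prob (A (?e n))) summable_on UNIV"
    using summable_on_reindex_bij_betw[of ?e UNIV I "\<lambda>i. prob (A i)"] assms(3) by simp
  then have "AE \<omega> in M. \<forall>\<^sub>F n in sequentially. \<omega> \<in> space M - A (?e n)"
    using False by (intro borel_cantelli_AE1)
      (auto intro!: assms(2) from_nat_into summable_on_imp_summable simp: emeasure_eq_measure)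
  then show ?thesis
  proof eventually_elim
    case (elim \<omega>)
    then obtain N where N: "\<And>n. n \<ge> N \<Longrightarrow> \<omega> \<notin> A (?e n)"
      by (auto simp: eventually_sequentially)
    have "{i\<in>I. \<omega> \<in> A i} \<subseteq> ?e ` {..<N}"
      using N from_nat_into_surj[OF assms(1)] by (force simp: not_le[symmetric])
    then show ?case by (rule finite_subset) simp
  qed
qed simp

text \<open>By independence and \<open>p \<le> exp (- (1 - p))\<close>, all \<open>A i\<close> with
  \<open>i\<close> in a finite \<open>J\<close> occur with probability at most \<open>exp\<close> of
  minus the sum over \<open>J\<close>. One failing index suffices, since the lemma will be applied
  to arbitrarily small neighbourhoods.\<close>

lemma (in prob_space) AE_not_all_if_not_summable_on:
  assumes "countable I" "indep_events A I" "\<not> (\<lambda>i. 1 - prob (A i)) summable_on I"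
  shows "AE \<omega> in M. \<exists>i\<in>I. \<omega> \<notin> A i"
proof -
  define N where "N = {\<omega>\<in>space M. \<forall>i\<in>I. \<omega> \<in> A i}"
  have A: "\<And>i. i \<in> I \<Longrightarrow> A i \<in> events"
    using assms(2) by (auto simp: indep_events_def)
  have "N = space M - (\<Union>i\<in>I. space M - A i)" by (auto simp: N_def)
  moreover have "(\<Union>i\<in>I. space M - A i) \<in> events"
    using A assms(1) by (intro sets.countable_UN') auto
  ultimately have [measurable]: "N \<in> events"
    by (metis sets.compl_sets)
  have bound: "prob N \<le> exp (- (\<Sum>i\<in>J. 1 - prob (A i)))" if J: "finite J" "J \<subseteq> I" for J
  proof (cases "J = {}")
    case False
    have "prob N \<le> prob (\<Inter>i\<in>J. A i)"
      using J False A by (intro finite_measure_mono sets.finite_INT) (auto simp: N_def)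
    also have "\<dots> = (\<Prod>i\<in>J. prob (A i))"
      using assms(2) J False by (auto simp: indep_events_def)
    also have "\<dots> \<le> (\<Prod>i\<in>J. exp (- (1 - prob (A i))))"
      using exp_ge_add_one_self[of "- (1 - prob (A i))" for i] by (intro prod_mono) auto
    also have "\<dots> = exp (- (\<Sum>i\<in>J. 1 - prob (A i)))"
      using J by (simp add: exp_sum flip: sum_negf)
    finally show ?thesis .
  qed simp
  have "prob N = 0"
  proof (rule ccontr)
    assume "prob N \<noteq> 0"
    then have pos: "prob N > 0" by (simp add: zero_less_measure_iff)
    \<comment> \<open>A positive probability would bound all finite partial sums, and these have
      nonnegative terms.\<close>
    have "(\<Sum>i\<in>J. 1 - prob (A i)) \<le> - ln (prob N)" if "finite J" "J \<subseteq> I" for J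
    proof -
      have "ln (prob N) \<le> - (\<Sum>i\<in>J. 1 - prob (A i))"
        using ln_mono[OF bound[OF that] pos] by simp
      then show ?thesis by linarith
    qed
    then have "(\<lambda>i. 1 - prob (A i)) summable_on I"
      by (intro nonneg_bdd_above_summable_on bdd_aboveI2[where M = "- ln (prob N)"]) auto
    then show False using assms(3) by simp
  qed
  then have "AE \<omega> in M. \<omega> \<notin> N"
    by (simp add: AE_iff_measurable[of N] emeasure_eq_measure prob_eq_0)
  then show ?thesis
    by (auto simp: N_def elim: AE_mp)
qed

text \<open>A compactness argument: if every point had summable one-sided neighbourhoods on both
  sides, bisection would give summability on the whole interval.\<close>

lemma not_summable_on_accumulation_point:
  fixes f :: "real \<Rightarrow> real"
  assumes "\<And>x. f x \<ge> 0" "\<not> f summable_on {x\<in>X. \<bar>x\<bar> \<le> m}"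
  shows "\<exists>z s :: real. \<bar>s\<bar> = 1 \<and> (\<forall>r>0. \<not> f summable_on {x\<in>X. 0 < s * (x - z) \<and> s * (x - z) < r})"
proof (rule ccontr)
  assume "\<not> ?thesis"
  then have *: "\<exists>r>0. f summable_on {x\<in>X. 0 < s * (x - z) \<and> s * (x - z) < r}" if "\<bar>s\<bar> = 1" for s z
    using that by blast
  have un: "f summable_on A \<union> B" if "f summable_on A" "f summable_on B" for A B
  proof -
    have "f summable_on A \<union> (B - A)"
      using that by (intro summable_on_Un_disjoint) (auto intro: summable_on_subset_banach)
    then show ?thesis by simp
  qed
  have "f summable_on {x\<in>X. -m \<le> x \<and> x \<le> m}"
  proof (cases "-m \<le> m")
    case True
    then show ?thesis
    proof (induction rule: Bolzano)
      case (trans a b c)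
      then show ?case
        by (intro summable_on_subset_banach[OF un[OF trans(1,2)]]) auto
    next
      case (local z)
      obtain r1 where r1: "r1 > 0" "f summable_on {x\<in>X. 0 < 1 * (x - z) \<and> 1 * (x - z) < r1}"
        using *[of 1 z] by auto
      obtain r2 where r2: "r2 > 0" "f summable_on {x\<in>X. 0 < -1 * (x - z) \<and> -1 * (x - z) < r2}"
        using *[of "-1" z] by auto
      have "f summable_on {x\<in>X. a \<le> x \<and> x \<le> b}" if "a \<le> z" "z \<le> b" "b - a < min r1 r2" for a b
        \<comment> \<open>The two one-sided neighbourhoods omit \<open>z\<close> itself, which adds
          a single term.\<close>
        by (rule summable_on_subset_banach[OF un[OF un[OF r1(2) r2(2)] summable_on_finite[of "{z}"]]])
          (use that in auto)
      then show ?case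
        using r1(1) r2(1) by (intro exI[of _ "min r1 r2"]) auto
    qed
  next
    case False
    then have empty: "{x\<in>X. -m \<le> x \<and> x \<le> m} = {}" by auto
    show ?thesis unfolding empty by simp
  qed
  moreover have "{x\<in>X. -m \<le> x \<and> x \<le> m} = {x\<in>X. \<bar>x\<bar> \<le> m}" by auto
  ultimately show False using assms(2) by simp
qed


text \<open>By completeness the exceptional set is itself a null set, so measurability comes with
  the almost sure statement.\<close>

lemma (in prob_space) complete_AE_imp_prob_1:
  assumes "complete_measure M" "AE \<omega> in M. Q \<omega>"
  shows "{\<omega>\<in>space M. Q \<omega>} \<in> events \<and> prob {\<omega>\<in>space M. Q \<omega>} = 1"
proof -
  interpret complete_measure M by fact
  have "{\<omega>\<in>space M. \<not> Q \<omega>} \<in> events"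
    using assms(2) by (auto simp: AE_iff_null_sets)
  then have "space M - {\<omega>\<in>space M. \<not> Q \<omega>} \<in> events" by auto
  moreover have "space M - {\<omega>\<in>space M. \<not> Q \<omega>} = {\<omega>\<in>space M. Q \<omega>}" by auto
  ultimately have "{\<omega>\<in>space M. Q \<omega>} \<in> events" by simp
  then show ?thesis using assms(2) by (simp add: prob_Collect_eq_1)
qed

lemma (in prob_space) complete_AE_not_imp_prob_0:
  assumes "complete_measure M" "AE \<omega> in M. \<not> Q \<omega>"
  shows "{\<omega>\<in>space M. Q \<omega>} \<in> events \<and> prob {\<omega>\<in>space M. Q \<omega>} = 0"
proof -
  interpret complete_measure M by fact
  have "{\<omega>\<in>space M. Q \<omega>} \<in> null_sets M"
    using assms(2) by (auto simp: AE_iff_null_sets)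
  then show ?thesis by (auto simp: measure_eq_0_null_sets)
qed

section \<open>Almost sure behaviour of independent stationary fibres\<close>

locale stationary_fibres = prob_space M for M :: "'w measure" +
  fixes X :: "real set" and Y :: "real \<Rightarrow> 'w \<Rightarrow> real set"
  assumes countable_X: "countable X"
    and random: "\<And>x. x \<in> X \<Longrightarrow> random_closed_set M (Y x)"
    and indep: "indep_vars (\<lambda>_. fell_borel) Y X"
    and prob_empty: "\<And>x. x \<in> X \<Longrightarrow> prob {\<omega> \<in> space M. Y x \<omega> = {}} = 0"
    and stationary: "\<And>x. x \<in> X \<Longrightarrow> first_order_stationary M (Y x)"
begin

definition miss :: "real \<Rightarrow> real \<Rightarrow> real \<Rightarrow> 'w set" where
  "miss x q e = {\<omega>\<in>space M. Y x \<omega> \<inter> {q-e..q+e} = {}}"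

lemma Y_measurable: "x \<in> X \<Longrightarrow> Y x \<in> measurable M fell_borel"
  using random by (simp add: random_closed_set_def)

lemma closed_Y: "x \<in> X \<Longrightarrow> \<omega> \<in> space M \<Longrightarrow> closed (Y x \<omega>)"
  using measurable_space[OF Y_measurable] by (auto simp: space_fell_borel)

lemma miss_sets:
  assumes "x \<in> X"
  shows "miss x q e \<in> events"
proof -
  have "miss x q e = Y x -` {F\<in>space fell_borel. F \<inter> {q-e..q+e} = {}} \<inter> space M"
    using measurable_space[OF Y_measurable[OF assms]] by (auto simp: miss_def)
  then show ?thesis
    using measurable_sets[OF Y_measurable[OF assms] fell_borel_miss[of "{q-e..q+e}"]] by simp
qed

lemma hit_eq: "{\<omega>\<in>space M. Y x \<omega> \<inter> {q-e..q+e} \<noteq> {}} = space M - miss x q e"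
  by (auto simp: miss_def)

text \<open>Stationarity speaks of hitting; shift \<open>{-e..e}\<close> by \<open>q\<close> and
  pass to complements.\<close>

lemma prob_miss:
  assumes "x \<in> X" "e \<ge> 0"
  shows "prob (miss x q e) = prob (miss x 0 e)"
proof -
  have "prob {\<omega> \<in> space M. Y x \<omega> \<inter> {- e + q..e + q} \<noteq> {}} = prob {\<omega> \<in> space M. Y x \<omega> \<inter> {- e..e} \<noteq> {}}"
    using stationary[OF assms(1), unfolded first_order_stationary_def, rule_format, of "- e" e q] assms(2) by simp
  then have "prob (space M - miss x q e) = prob (space M - miss x 0 e)"
    unfolding hit_eq[symmetric] by (simp add: add.commute)
  then show ?thesis using miss_sets[OF assms(1)] by (simp add: prob_compl)
qed

lemma dist_zero_event: "x \<in> X \<Longrightarrow> {\<omega>\<in>space M. dist_zero (Y x \<omega>) > ereal e} = miss x 0 e"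
  by (simp add: miss_def closed_Y less_dist_zero_iff cong: conj_cong)

lemma AE_nonempty: "AE \<omega> in M. \<forall>x\<in>X. Y x \<omega> \<noteq> {}"
proof (subst AE_ball_countable[OF countable_X], intro ballI)
  fix x assume x: "x \<in> X"
  \<comment> \<open>Emptiness is the complement of hitting the open set \<open>UNIV\<close>.
    Measurability matters here, because \<open>measure\<close> is also 0 on sets that are not
    events.\<close>
  have "{\<omega>\<in>space M. Y x \<omega> = {}} = space M - Y x -` {F\<in>space fell_borel. F \<inter> UNIV \<noteq> {}} \<inter> space M"
    using measurable_space[OF Y_measurable[OF x]] by auto
  then have "{\<omega>\<in>space M. Y x \<omega> = {}} \<in> events"
    using measurable_sets[OF Y_measurable[OF x] fell_borel_hit[of UNIV]] by auto
  then show "AE \<omega> in M. Y x \<omega> \<noteq> {}"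
    using prob_empty[OF x] by (intro AE_I[where N = "{\<omega>\<in>space M. Y x \<omega> = {}}"]) (auto simp: emeasure_eq_measure)
qed

text \<open>Centres and radii are restricted to a countable grid, so that the exceptional null sets
  can be united.\<close>

lemma AE_finite_miss:
  assumes "\<forall>m::nat. \<forall>e>0. (\<lambda>x. prob (miss x 0 e)) summable_on {x\<in>X. \<bar>x\<bar> \<le> real m}"
  shows "AE \<omega> in M. \<forall>(m::nat) (n::nat) (k::int).
           finite {x\<in>X. \<bar>x\<bar> \<le> real m \<and> Y x \<omega> \<inter> {k / Suc n - 1 / Suc n..k / Suc n + 1 / Suc n} = {}}"
proof (intro AE_all_countable[THEN iffD2] allI)
  fix m n :: nat and k :: int
  let ?I = "{x\<in>X. \<bar>x\<bar> \<le> real m}" and ?e = "1 / real (Suc n)" and ?q = "k / real (Suc n)"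
  have "(\<lambda>x. prob (miss x ?q ?e)) summable_on ?I"
    using assms[rule_format, of ?e m] prob_miss[of _ ?e ?q] by (subst summable_on_cong[where g = "\<lambda>x. prob (miss x 0 ?e)"]) auto
  then have "AE \<omega> in M. finite {x\<in>?I. \<omega> \<in> miss x ?q ?e}"
    using countable_X miss_sets by (intro AE_finite_if_summable_on) auto
  then show "AE \<omega> in M. finite {x\<in>X. \<bar>x\<bar> \<le> real m \<and> Y x \<omega> \<inter> {?q - ?e..?q + ?e} = {}}"
    by (rule AE_mp) (auto intro!: AE_I2 simp: miss_def elim!: rev_finite_subset)
qed

lemma AE_locally_full:
  assumes "\<forall>m::nat. \<forall>e>0. (\<lambda>x. prob (miss x 0 e)) summable_on {x\<in>X. \<bar>x\<bar> \<le> real m}"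
  shows "AE \<omega> in M. locally_full X (\<lambda>x. Y x \<omega>)"
  using AE_finite_miss[OF assms] AE_nonempty
proof eventually_elim
  case (elim \<omega>)
  show ?case
  proof
    fix m :: nat and R e :: real assume "e > 0"
    \<comment> \<open>Half of \<open>e\<close> is needed: the grid interval around the grid point
      just below \<open>y\<close> may reach almost \<open>2 / Suc n\<close> below
      \<open>y\<close>.\<close>
    then obtain n :: nat where n: "1 / real (Suc n) < e / 2"
      using nat_approx_posE[of "e/2"] by auto
    \<comment> \<open>Bounds \<lfloor>\<open>y * Suc n\<close>\<rfloor> for all \<open>y\<close>
      with \<open>\<bar>y\<bar> \<le> R\<close>, so finitely many grid intervals are
      involved.\<close>
    define K where "K = \<lceil>\<bar>R\<bar> * Suc n\<rceil> + 1"
    let ?Z = "\<lambda>k::int. {x\<in>X. \<bar>x\<bar> \<le> real m \<and> Y x \<omega> \<inter> {k / Suc n - 1 / Suc n..k / Suc n + 1 / Suc n} = {}}"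
    have "x \<in> (\<Union>k\<in>{-K..K}. ?Z k)"
      if x: "x \<in> X" "\<bar>x\<bar> \<le> real m" "\<bar>y\<bar> \<le> R" "Y x \<omega> \<inter> {y-e..y+e} = {}" for x y
    proof -
      define k where "k = \<lfloor>y * Suc n\<rfloor>"
      have ky: "real_of_int k \<le> y * Suc n" "y * Suc n < k + 1" unfolding k_def by linarith+
      have "\<bar>y * Suc n\<bar> \<le> \<bar>R\<bar> * Suc n"
        using x(3) by (auto simp: abs_mult intro!: mult_right_mono)
      then have "k \<in> {-K..K}"
        unfolding k_def K_def by (simp; linarith)
      moreover have "k / Suc n \<le> y" "y < k / Suc n + 1 / Suc n"
        using ky by (simp_all add: field_simps)
      then have "{k / Suc n - 1 / Suc n..k / Suc n + 1 / Suc n} \<subseteq> {y-e..y+e}"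
        using n by (simp; linarith)
      ultimately show ?thesis using x by blast
    qed
    moreover have "finite (\<Union>k\<in>{-K..K}. ?Z k)" using elim(1) by blast
    ultimately show "finite {x\<in>X. \<bar>x\<bar> \<le> real m \<and> (\<exists>y. \<bar>y\<bar> \<le> R \<and> Y x \<omega> \<inter> {y-e..y+e} = {})}"
      by (elim rev_finite_subset) blast
  qed (use elim countable_X in auto)
qed

text \<open>Hitting a compact interval is a Borel condition for the Fell topology, so these events
  inherit independence. Divergence at centre \<open>0\<close> passes to centre \<open>q\<close> by
  stationarity.\<close>

lemma AE_ex_miss:
  assumes "I \<subseteq> X" "e > 0" "\<not> (\<lambda>x. prob (miss x 0 e)) summable_on I"
  shows "AE \<omega> in M. \<exists>x\<in>I. Y x \<omega> \<inter> {q-e..q+e} = {}"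
proof -
  let ?A = "\<lambda>x. {\<omega>\<in>space M. Y x \<omega> \<inter> {q-e..q+e} \<noteq> {}}"
  have "{F\<in>space fell_borel. F \<inter> {q-e..q+e} \<noteq> {}} = space fell_borel - {F\<in>space fell_borel. F \<inter> {q-e..q+e} = {}}"
    by auto
  then have "{F\<in>space fell_borel. F \<inter> {q-e..q+e} \<noteq> {}} \<in> sets fell_borel"
    using sets.compl_sets[OF fell_borel_miss[OF compact_Icc[of "q-e" "q+e"]]] by simp
  then have ind: "indep_events ?A I"
    by (intro indep_eventsI_indep_vars[OF indep_vars_subset[OF indep assms(1)]])
  have "1 - prob (?A x) = prob (miss x 0 e)" if "x \<in> I" for x
    unfolding hit_eq using miss_sets prob_miss[of x e q] that assms by (auto simp: prob_compl subset_iff)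
  then have "\<not> (\<lambda>x. 1 - prob (?A x)) summable_on I"
    using assms(3) summable_on_cong[of I "\<lambda>x. 1 - prob (?A x)" "\<lambda>x. prob (miss x 0 e)"] by simp
  then have "AE \<omega> in M. \<exists>x\<in>I. \<omega> \<notin> ?A x"
    using countable_subset[OF assms(1) countable_X] ind by (intro AE_not_all_if_not_summable_on)
  then show ?thesis by (rule AE_mp) (auto intro!: AE_I2)
qed

text \<open>The point \<open>z\<close> and the side \<open>s\<close> are found from the
  probabilities alone and hence do not depend on the outcome. Rational centres and radii
  \<open>1 / Suc n\<close> leave only countably many null sets.\<close>

lemma AE_no_path:
  assumes "e > 0" "\<not> (\<lambda>x. prob (miss x 0 e)) summable_on {x\<in>X. \<bar>x\<bar> \<le> m}"
  obtains z s where "AE \<omega> in M. \<nexists>g. path g \<and> path_image g \<subseteq> V_set X (\<lambda>x. Y x \<omega>) \<and>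
    fst (pathstart g) = z \<and> fst (pathfinish g) = z + s"
proof -
  obtain z s where s: "\<bar>s\<bar> = 1" and
    ns: "\<And>r. r > 0 \<Longrightarrow> \<not> (\<lambda>x. prob (miss x 0 e)) summable_on {x\<in>X. 0 < s * (x - z) \<and> s * (x - z) < r}"
    using not_summable_on_accumulation_point[OF measure_nonneg assms(2)] by blast
  have "AE \<omega> in M. \<forall>q\<in>\<rat>. \<forall>n. \<exists>x\<in>{x\<in>X. 0 < s * (x - z) \<and> s * (x - z) < 1 / Suc n}. Y x \<omega> \<inter> {q-e..q+e} = {}"
    by (intro AE_ball_countable[OF countable_rat, THEN iffD2] ballI AE_all_countable[THEN iffD2] allI
        AE_ex_miss assms(1) ns) auto
  then have "AE \<omega> in M. \<nexists>g. path g \<and> path_image g \<subseteq> V_set X (\<lambda>x. Y x \<omega>) \<and>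
    fst (pathstart g) = z \<and> fst (pathfinish g) = z + s"
  proof eventually_elim
    case (elim \<omega>)
    have miss: "\<exists>x\<in>X. 0 < s * (x - z) \<and> s * (x - z) < r \<and> Y x \<omega> \<inter> {q-e..q+e} = {}"
      if "q \<in> \<rat>" "r > 0" for q r
    proof -
      obtain n where "1 / Suc n < r" using nat_approx_posE[OF \<open>r > 0\<close>] by auto
      moreover have "\<exists>x\<in>{x\<in>X. 0 < s * (x - z) \<and> s * (x - z) < 1 / Suc n}. Y x \<omega> \<inter> {q-e..q+e} = {}"
        using elim[THEN bspec, OF that(1)] by (rule spec)
      then obtain x where "x \<in> X" "0 < s * (x - z)" "s * (x - z) < 1 / Suc n" "Y x \<omega> \<inter> {q-e..q+e} = {}"
        by (elim bexE CollectE conjE)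
      ultimately show ?thesis by (intro bexI[of _ x] conjI) simp_all
    qed
    show ?case
      by (rule notI, elim exE conjE, rule no_path_V_set[OF s assms(1) miss])
  qed
  then show ?thesis using that by blast
qed

text \<open>Nonempty fibres give points of the set over \<open>z\<close> and \<open>z + s\<close>,
  which a path would have to join. The graph of a continuous selection over this segment would be
  such a path too.\<close>

lemma AE_not_path_connected_no_selection:
  assumes "e > 0" "\<not> (\<lambda>x. prob (miss x 0 e)) summable_on {x\<in>X. \<bar>x\<bar> \<le> m}"
  shows "AE \<omega> in M. \<not> path_connected (V_set X (\<lambda>x. Y x \<omega>)) \<and>
    \<not> (\<exists>f::real \<Rightarrow> real. continuous_on UNIV f \<and> (\<forall>x\<in>X. f x \<in> Y x \<omega>))"
proof -
  obtain z s where "AE \<omega> in M. \<nexists>g. path g \<and> path_image g \<subseteq> V_set X (\<lambda>x. Y x \<omega>) \<and>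
    fst (pathstart g) = z \<and> fst (pathfinish g) = z + s"
    using AE_no_path[OF assms] .
  then show ?thesis
    using AE_nonempty
  proof eventually_elim
    case (elim \<omega>)
    let ?V = "V_set X (\<lambda>x. Y x \<omega>)"
    have "\<not> path_connected ?V"
    proof
      assume pc: "path_connected ?V"
      have "\<exists>c. (x, c) \<in> ?V" for x
        using elim(2) by (cases "x \<in> X") (auto simp: V_set_def)
      then obtain a b where "(z, a) \<in> ?V" "(z + s, b) \<in> ?V" by blast
      then show False
        using pc elim(1) unfolding path_connected_def by (metis fst_conv)
    qed
    moreover have False if f: "continuous_on UNIV f" "\<forall>x\<in>X. f x \<in> Y x \<omega>" for f :: "real \<Rightarrow> real"
    proof -
      let ?g = "\<lambda>t. (z + t * s, f (z + t * s))"
      have "continuous_on {0..1} (\<lambda>t. f (z + t * s))"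
        by (rule continuous_on_compose2[OF f(1)]) (auto intro!: continuous_intros)
      then have "path ?g" unfolding path_def by (intro continuous_intros)
      moreover have "path_image ?g \<subseteq> ?V" using f(2) by (auto simp: path_image_def V_set_def)
      moreover have "fst (pathstart ?g) = z" "fst (pathfinish ?g) = z + s"
        by (simp_all add: pathstart_def pathfinish_def)
      ultimately show False using elim(1) by blast
    qed
    ultimately show ?case by blast
  qed
qed

end

theorem theorem4:
  fixes M :: "'w measure"
    and X :: "real set"
    and Y :: "real \<Rightarrow> 'w \<Rightarrow> real set"
  assumes "prob_space M"
    and "complete_measure M"
    and "countable X"
    and "infinite X"
    and "\<And>x. x \<in> X \<Longrightarrow> random_closed_set M (Y x)"
    and "prob_space.indep_vars M (\<lambda>_. fell_borel) Y X"
    and "\<And>x. x \<in> X \<Longrightarrow> measure M {\<omega> \<in> space M. Y x \<omega> = {}} = 0"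
    and "\<And>x. x \<in> X \<Longrightarrow> first_order_stationary M (Y x)"
  shows "event_C M X Y \<in> sets M \<and> event_path_connected M X Y \<in> sets M \<and>
    (if \<forall>m::nat. \<forall>\<epsilon>::real. \<epsilon> > 0 \<longrightarrow>
          (\<lambda>x. measure M {\<omega> \<in> space M. dist_zero (Y x \<omega>) > ereal \<epsilon>})
            summable_on {x \<in> X. \<bar>x\<bar> \<le> real m}
     then measure M (event_C M X Y) = 1 \<and> measure M (event_path_connected M X Y) = 1
     else measure M (event_C M X Y) = 0 \<and> measure M (event_path_connected M X Y) = 0)"
proof -
  interpret prob_space M by fact
  interpret stationary_fibres M X Y
    by unfold_locales (use assms in auto)
  let ?C = "\<lambda>\<omega>. \<exists>f::real \<Rightarrow> real. continuous_on UNIV f \<and> (\<forall>x\<in>X. f x \<in> Y x \<omega>)"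
    and ?P = "\<lambda>\<omega>. path_connected (V_set X (\<lambda>x. Y x \<omega>))"
  have dist: "(\<lambda>x. prob {\<omega> \<in> space M. dist_zero (Y x \<omega>) > ereal e}) summable_on {x\<in>X. \<bar>x\<bar> \<le> real m} \<longleftrightarrow>
      (\<lambda>x. prob (miss x 0 e)) summable_on {x\<in>X. \<bar>x\<bar> \<le> real m}" for e m
    by (rule summable_on_cong) (auto simp: dist_zero_event)
  show ?thesis
  proof (cases "\<forall>m::nat. \<forall>e>0. (\<lambda>x. prob (miss x 0 e)) summable_on {x\<in>X. \<bar>x\<bar> \<le> real m}")
    case True
    then have full: "AE \<omega> in M. locally_full X (\<lambda>x. Y x \<omega>)"
      by (rule AE_locally_full)
    then have "AE \<omega> in M. ?P \<omega>"
      by eventually_elim (rule locally_full.V_path_connected)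
    moreover have "AE \<omega> in M. ?C \<omega>"
      using full by eventually_elim (metis locally_full.selection)
    ultimately have "AE \<omega> in M. ?C \<omega>" "AE \<omega> in M. ?P \<omega>" by auto
    from this[THEN complete_AE_imp_prob_1[OF assms(2)]] show ?thesis
      using True unfolding dist event_C_def event_path_connected_def by simp
  next
    case False
    then obtain e m where "e > 0" "\<not> (\<lambda>x. prob (miss x 0 e)) summable_on {x\<in>X. \<bar>x\<bar> \<le> real m}"
      by blast
    then have "AE \<omega> in M. \<not> ?P \<omega> \<and> \<not> ?C \<omega>"
      by (rule AE_not_path_connected_no_selection)
    then have "AE \<omega> in M. \<not> ?C \<omega>" "AE \<omega> in M. \<not> ?P \<omega>" by auto
    from this[THEN complete_AE_not_imp_prob_0[OF assms(2)]] show ?thesis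
      using False unfolding dist event_C_def event_path_connected_def by simp
  qed
qed

end
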